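(* For every integer $n\ge 0$, the integer $3^n$ expressed in base $\frac{3}{2}$ is equal to $2^n$ expressed in base $\frac32$ with $n$ zeros appended at the end.
   Context: The base-$3/2$ representation of a nonnegative integer $m$ is obtained as follows ("exploding dots"): place $m$ dots in the rightmost box of a row of boxes extending infinitely to the left; whenever a box contains at least three dots, remove three dots from it and place two dots in the box immediately to its left; continue until every box contains $0$, $1$ or $2$ dots. The numbers of dots, read from left to right starting with the leftmost nonempty box, are the digits of $m$ in base $3/2$ (the representation of $0$ is $0$). If the digits are $d_{k-1}\cdots d_1d_0$ then $m=\sum_i d_i(3/2)^i$. *)

theory Defs
  imports "HOL-Library.Confluence"
begin

text \<open>
  A row of boxes is a function \<open>c :: nat \<Rightarrow> nat\<close>: \<open>c i\<close> is the number of dots in the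
  \<open>i\<close>-th box counted from the right, so box \<open>i + 1\<close> is immediately to the left of box \<open>i\<close>.
\<close>

definition start_boxes :: "nat \<Rightarrow> nat \<Rightarrow> nat" where
  "start_boxes m = (\<lambda>i. if i = 0 then m else 0)"

inductive explode :: "(nat \<Rightarrow> nat) \<Rightarrow> (nat \<Rightarrow> nat) \<Rightarrow> bool" where
  "c i \<ge> 3 \<Longrightarrow> explode c (c(i := c i - 3, i + 1 := c (i + 1) + 2))"

definition stable_boxes :: "(nat \<Rightarrow> nat) \<Rightarrow> bool" where
  "stable_boxes c \<longleftrightarrow> (\<forall>i. c i < 3)"

text \<open>
  The description operator is justified by the theorem \<open>final_boxes_unique_existence\<close> below.
  Every explosion decreases the total number of dots (\<open>explode_sum\<close>), so the process also
  terminates whatever boxes are chosen.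
\<close>

definition final_boxes :: "nat \<Rightarrow> nat \<Rightarrow> nat" where
  "final_boxes m = (THE d. explode\<^sup>*\<^sup>* (start_boxes m) d \<and> stable_boxes d)"

definition read_digits :: "(nat \<Rightarrow> nat) \<Rightarrow> nat list" where
  "read_digits d =
     (if \<forall>i. d i = 0 then [0] else map d (rev [0..<Suc (Max {i. d i \<noteq> 0})]))"

text \<open>The digits are listed from the most significant one to the least significant one.\<close>

definition base_three_halves :: "nat \<Rightarrow> nat list" where
  "base_three_halves m = read_digits (final_boxes m)"

lemma explode_commute:
  assumes "explode c d" "explode c e"
  shows "d = e \<or> (\<exists>f. explode d f \<and> explode e f)"
proof -
  obtain i where i: "c i \<ge> 3" "d = c(i := c i - 3, i + 1 := c (i + 1) + 2)"
    using assms(1) by (auto elim: explode.cases)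
  obtain j where j: "c j \<ge> 3" "e = c(j := c j - 3, j + 1 := c (j + 1) + 2)"
    using assms(2) by (auto elim: explode.cases)
  show ?thesis
  proof (cases "i = j")
    case True
    then show ?thesis using i j by simp
  next
    case False
    have di: "d j \<ge> 3" and ej: "e i \<ge> 3" using i j False by auto
    have "d(j := d j - 3, j + 1 := d (j + 1) + 2) = e(i := e i - 3, i + 1 := e (i + 1) + 2)"
    proof
      fix k
      show "(d(j := d j - 3, j + 1 := d (j + 1) + 2)) k = (e(i := e i - 3, i + 1 := e (i + 1) + 2)) k"
        unfolding i(2) j(2) using i(1) j(1) False by auto
    qed
    then show ?thesis
      using explode.intros[of d j, OF di] explode.intros[of e i, OF ej] by metis
  qed
qed

lemma explode_confluent: "confluentp explode"
proof (rule strong_confluentp_imp_confluentp, rule strong_confluentpI)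
  fix x y y' assume "explode x y" "explode x y'"
  then show "\<exists>z. explode\<^sup>*\<^sup>* y z \<and> explode\<^sup>=\<^sup>= y' z"
    using explode_commute[of x y y'] by blast
qed

lemma stable_boxes_rtranclp:
  assumes "explode\<^sup>*\<^sup>* c d" "stable_boxes c"
  shows "d = c"
  using assms
proof (cases rule: converse_rtranclpE)
  case (step y)
  then obtain i where "c i \<ge> 3" by (auto elim: explode.cases)
  then show ?thesis using assms(2) unfolding stable_boxes_def by (meson not_less)
qed simp

lemma explode_sum:
  assumes "explode c d" "finite {i. c i \<noteq> 0}"
  shows "finite {i. d i \<noteq> 0}" "(\<Sum>i | d i \<noteq> 0. d i) < (\<Sum>i | c i \<noteq> 0. c i)"
proof -
  obtain i where i: "c i \<ge> 3" "d = c(i := c i - 3, i + 1 := c (i + 1) + 2)"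
    using assms(1) by (auto elim: explode.cases)
  define S where "S = {i. c i \<noteq> 0} - {i, i + 1}"
  have fS: "finite S" using assms(2) by (simp add: S_def)
  have sub: "{i. d i \<noteq> 0} \<subseteq> insert i (insert (i + 1) S)" using i by (auto simp: S_def)
  show "finite {i. d i \<noteq> 0}" using finite_subset[OF sub] fS by simp
  have "(\<Sum>i | d i \<noteq> 0. d i) = sum d (insert i (insert (i + 1) S))"
    by (rule sum.mono_neutral_left) (use sub fS in auto)
  also have "\<dots> = d i + (d (i + 1) + sum d S)"
    using fS by (simp add: S_def)
  also have "sum d S = sum c S" by (rule sum.cong) (auto simp: i S_def)
  also have "d i + (d (i + 1) + sum c S) < c i + (c (i + 1) + sum c S)" using i by simp
  also have "\<dots> = sum c (insert i (insert (i + 1) S))" using fS by (simp add: S_def)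
  also have "\<dots> = (\<Sum>i | c i \<noteq> 0. c i)"
    by (rule sum.mono_neutral_right) (use fS in \<open>auto simp: S_def\<close>)
  finally show "(\<Sum>i | d i \<noteq> 0. d i) < (\<Sum>i | c i \<noteq> 0. c i)" .
qed

lemma explode_terminates:
  assumes "finite {i. c i \<noteq> 0}"
  shows "\<exists>d. explode\<^sup>*\<^sup>* c d \<and> stable_boxes d"
  using assms
proof (induction "\<Sum>i | c i \<noteq> 0. c i" arbitrary: c rule: less_induct)
  case less
  show ?case
  proof (cases "stable_boxes c")
    case True
    then show ?thesis by blast
  next
    case False
    then obtain i where "c i \<ge> 3" by (auto simp: stable_boxes_def not_less)
    then obtain d where d: "explode c d" using explode.intros by blast
    obtain e where "explode\<^sup>*\<^sup>* d e" "stable_boxes e"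
      using less.hyps[OF explode_sum(2)[OF d less.prems] explode_sum(1)[OF d less.prems]] by blast
    then show ?thesis using d by (meson converse_rtranclp_into_rtranclp)
  qed
qed

theorem final_boxes_unique_existence: "\<exists>!d. explode\<^sup>*\<^sup>* (start_boxes m) d \<and> stable_boxes d"
proof -
  have "finite {i. start_boxes m i \<noteq> 0}"
    by (rule finite_subset[of _ "{0}"]) (auto simp: start_boxes_def)
  then have "\<exists>d. explode\<^sup>*\<^sup>* (start_boxes m) d \<and> stable_boxes d" by (rule explode_terminates)
  moreover have "d = e" if h: "explode\<^sup>*\<^sup>* (start_boxes m) d \<and> stable_boxes d"
    "explode\<^sup>*\<^sup>* (start_boxes m) e \<and> stable_boxes e" for d e
  proof -
    obtain f where "explode\<^sup>*\<^sup>* d f" "explode\<^sup>*\<^sup>* e f"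
      using confluentpD[OF explode_confluent conjunct1[OF h(1)] conjunct1[OF h(2)]] by blast
    then have "f = d" "f = e"
      using stable_boxes_rtranclp conjunct2[OF h(1)] conjunct2[OF h(2)] by blast+
    then show ?thesis by simp
  qed
  ultimately show ?thesis by (elim exE) (rule ex1I)
qed

theorem final_boxes_props:
  "explode\<^sup>*\<^sup>* (start_boxes m) (final_boxes m)" "stable_boxes (final_boxes m)"
  "finite {i. final_boxes m i \<noteq> 0}"
proof -
  show 1: "explode\<^sup>*\<^sup>* (start_boxes m) (final_boxes m)" and "stable_boxes (final_boxes m)"
    using theI'[OF final_boxes_unique_existence[of m]] by (simp_all add: final_boxes_def)
  show "finite {i. final_boxes m i \<noteq> 0}"
    using 1
  proof (induction rule: rtranclp_induct)
    case base
    show ?case by (rule finite_subset[of _ "{0}"]) (auto simp: start_boxes_def)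
  next
    case (step y z)
    then show ?case using explode_sum(1) by blast
  qed
qed

end

theory Submission
  imports Defs
begin

text \<open>
  Exploding the rightmost box of \<open>3 * k\<close> dots exactly \<open>k\<close> times empties it and leaves \<open>2 * k\<close>
  dots in the next box: this is the starting row of \<open>2 * k\<close>, moved one box to the left
  (\<open>start_boxes_times_3\<close>). Since explosions do not depend on the position of the boxes, a shifted
  row evolves as the original one does (\<open>explode_shift\<close>), so this can be repeated: \<open>3 ^ n\<close> dots
  reach the starting row of \<open>2 ^ n\<close> moved \<open>n\<close> boxes to the left. Let the process for \<open>2 ^ n\<close> run
  to its end there. The row reached is stable, so by uniqueness of the stable row it is the final
  row for \<open>3 ^ n\<close>. Shifting a nonzero row by \<open>n\<close> boxes appends \<open>n\<close> zeros to its digits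
  (\<open>read_digits_shift\<close>).
\<close>

definition shift_boxes :: "nat \<Rightarrow> (nat \<Rightarrow> nat) \<Rightarrow> nat \<Rightarrow> nat" where
  "shift_boxes n c = (\<lambda>i. if i < n then 0 else c (i - n))"

lemma shift_boxes_0 [simp]: "shift_boxes 0 c = c"
  by (simp add: shift_boxes_def)

lemma shift_boxes_shift_boxes: "shift_boxes m (shift_boxes n c) = shift_boxes (m + n) c"
  by (auto simp: shift_boxes_def fun_eq_iff)

lemma explode_shift:
  assumes "explode c d"
  shows "explode (shift_boxes n c) (shift_boxes n d)"
proof -
  obtain i where i: "c i \<ge> 3" "d = c(i := c i - 3, i + 1 := c (i + 1) + 2)"
    using assms by (auto elim: explode.cases)
  let ?c = "shift_boxes n c"
  have "shift_boxes n d = ?c(i + n := ?c (i + n) - 3, i + n + 1 := ?c (i + n + 1) + 2)"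
    by (auto simp: i(2) shift_boxes_def fun_eq_iff)
  moreover have "?c (i + n) \<ge> 3"
    using i(1) by (simp add: shift_boxes_def)
  ultimately show ?thesis
    using explode.intros[of ?c "i + n"] by simp
qed

lemma explodes_shift:
  assumes "explode\<^sup>*\<^sup>* c d"
  shows "explode\<^sup>*\<^sup>* (shift_boxes n c) (shift_boxes n d)"
  using assms
proof (induction rule: rtranclp_induct)
  case (step d e)
  show ?case
    by (rule rtranclp.rtrancl_into_rtrancl[OF step.IH]) (rule explode_shift[OF step.hyps(2)])
qed simp

lemma stable_boxes_shift: "stable_boxes c \<Longrightarrow> stable_boxes (shift_boxes n c)"
  by (simp add: stable_boxes_def shift_boxes_def)

lemma explodes_same_box:
  assumes "3 * k \<le> c i"
  shows "explode\<^sup>*\<^sup>* c (c(i := c i - 3 * k, i + 1 := c (i + 1) + 2 * k))"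
  using assms
proof (induction k)
  case 0
  then show ?case by simp
next
  case (Suc k)
  let ?d = "c(i := c i - 3 * k, i + 1 := c (i + 1) + 2 * k)"
  let ?e = "c(i := c i - 3 * Suc k, i + 1 := c (i + 1) + 2 * Suc k)"
  have "?e = ?d(i := ?d i - 3, i + 1 := ?d (i + 1) + 2)"
    by (simp add: fun_eq_iff)
  moreover have "explode ?d (?d(i := ?d i - 3, i + 1 := ?d (i + 1) + 2))"
    by (rule explode.intros) (use Suc.prems in simp)
  ultimately have "explode ?d ?e"
    by (simp only:)
  moreover have "explode\<^sup>*\<^sup>* c ?d"
    by (rule Suc.IH) (use Suc.prems in simp)
  ultimately show ?case
    by (rule rtranclp.rtrancl_into_rtrancl[rotated])
qed

lemma start_boxes_times_3:
  "explode\<^sup>*\<^sup>* (start_boxes (3 * k)) (shift_boxes 1 (start_boxes (2 * k)))"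
proof -
  let ?c = "start_boxes (3 * k)"
  have "?c(0 := ?c 0 - 3 * k, 0 + 1 := ?c (0 + 1) + 2 * k) = shift_boxes 1 (start_boxes (2 * k))"
    by (auto simp: start_boxes_def shift_boxes_def fun_eq_iff)
  then show ?thesis
    using explodes_same_box[of k ?c 0] by (simp add: start_boxes_def)
qed

text \<open>
  The factor \<open>k\<close> is there for the induction: emptying the rightmost box replaces a factor \<open>3\<close> by
  a factor \<open>2\<close>, which \<open>k\<close> takes up while the exponent of \<open>3\<close> decreases.
\<close>

lemma start_boxes_times_power_3:
  "explode\<^sup>*\<^sup>* (start_boxes (3 ^ n * k)) (shift_boxes n (start_boxes (2 ^ n * k)))"
proof (induction n arbitrary: k)
  case 0
  then show ?case by simp
next
  case (Suc n)
  have "explode\<^sup>*\<^sup>* (start_boxes (3 ^ Suc n * k)) (shift_boxes 1 (start_boxes (3 ^ n * (2 * k))))"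
    using start_boxes_times_3[of "3 ^ n * k"] by (simp only: power_Suc mult.assoc mult.left_commute)
  moreover have "explode\<^sup>*\<^sup>* (shift_boxes 1 (start_boxes (3 ^ n * (2 * k))))
      (shift_boxes 1 (shift_boxes n (start_boxes (2 ^ n * (2 * k)))))"
    by (rule explodes_shift[OF Suc.IH])
  moreover have "shift_boxes 1 (shift_boxes n (start_boxes (2 ^ n * (2 * k)))) =
      shift_boxes (Suc n) (start_boxes (2 ^ Suc n * k))"
    by (simp add: shift_boxes_shift_boxes mult.left_commute mult.assoc)
  ultimately show ?case
    by (metis rtranclp_trans)
qed

lemma final_boxes_eqI:
  assumes "explode\<^sup>*\<^sup>* (start_boxes m) d" "stable_boxes d"
  shows "final_boxes m = d"
  unfolding final_boxes_def
  by (rule the1_equality[OF final_boxes_unique_existence]) (simp add: assms)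

lemma final_boxes_times_power_3:
  "final_boxes (3 ^ n * k) = shift_boxes n (final_boxes (2 ^ n * k))"
proof (rule final_boxes_eqI)
  show "explode\<^sup>*\<^sup>* (start_boxes (3 ^ n * k)) (shift_boxes n (final_boxes (2 ^ n * k)))"
    using start_boxes_times_power_3 explodes_shift[OF final_boxes_props(1)]
    by (rule rtranclp_trans)
qed (simp add: stable_boxes_shift final_boxes_props)

lemma final_boxes_nonzero:
  assumes "m > 0"
  shows "\<exists>i. final_boxes m i \<noteq> 0"
  using final_boxes_props(1)[of m]
proof (cases rule: rtranclp.cases)
  case rtrancl_refl
  then show ?thesis
    using assms by (auto simp: start_boxes_def)
next
  \<comment> \<open>The last explosion has put two dots into some box.\<close>
  case (rtrancl_into_rtrancl c)
  then obtain i where "final_boxes m = c(i := c i - 3, i + 1 := c (i + 1) + 2)"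
    by (auto elim: explode.cases)
  then have "final_boxes m (i + 1) \<noteq> 0"
    by simp
  then show ?thesis ..
qed

text \<open>
  The zero row has to be excluded: it equals its shifts, so that both are read as the
  single digit \<open>0\<close>.
\<close>

lemma read_digits_shift:
  assumes fin: "finite {i. d i \<noteq> 0}" and nz: "\<exists>i. d i \<noteq> 0"
  shows "read_digits (shift_boxes n d) = read_digits d @ replicate n 0"
proof -
  let ?M = "Max {i. d i \<noteq> 0}"
  let ?s = "shift_boxes n d"
  have supp: "{i. ?s i \<noteq> 0} = (\<lambda>i. i + n) ` {i. d i \<noteq> 0}"
  proof (intro equalityI subsetI)
    fix i assume "i \<in> {i. ?s i \<noteq> 0}"
    then have "i = (i - n) + n" "d (i - n) \<noteq> 0"
      by (auto simp: shift_boxes_def split: if_splits)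
    then show "i \<in> (\<lambda>i. i + n) ` {i. d i \<noteq> 0}"
      by blast
  qed (auto simp: shift_boxes_def)
  have top: "Max {i. ?s i \<noteq> 0} = ?M + n"
    unfolding supp using fin nz by (subst Max_add_commute) auto
  have nz': "\<exists>i. ?s i \<noteq> 0"
    using supp nz by blast
  have "map ?s [0..<Suc ?M + n] = map ?s [0..<n] @ map ?s [n..<Suc ?M + n]"
    using upt_add_eq_append[of 0 n "Suc ?M"] by (simp only: map_append add.commute add_0 le0)
  also have "map ?s [0..<n] = replicate n 0"
    by (rule nth_equalityI) (auto simp: shift_boxes_def)
  also have "map ?s [n..<Suc ?M + n] = map d [0..<Suc ?M]"
    by (rule nth_equalityI) (auto simp: shift_boxes_def simp del: upt_Suc)
  finally have "rev (map ?s [0..<Suc ?M + n]) = rev (map d [0..<Suc ?M]) @ replicate n 0"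
    by simp
  moreover have "read_digits ?s = rev (map ?s [0..<Suc ?M + n])"
    using nz' unfolding read_digits_def top by (auto simp: rev_map simp del: upt_Suc neq0_conv)
  moreover have "read_digits d = rev (map d [0..<Suc ?M])"
    using nz unfolding read_digits_def by (auto simp: rev_map simp del: upt_Suc neq0_conv)
  ultimately show ?thesis
    by simp
qed

theorem lemma11:
  fixes n :: nat
  shows "base_three_halves (3 ^ n) = base_three_halves (2 ^ n) @ replicate n 0"
proof -
  have "final_boxes (3 ^ n) = shift_boxes n (final_boxes (2 ^ n))"
    using final_boxes_times_power_3[of n 1] by simp
  then show ?thesis
    unfolding base_three_halves_def
    using read_digits_shift[OF final_boxes_props(3) final_boxes_nonzero, of "2 ^ n" n] by simp
qed

end
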